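(* Let $r\ge 1$ be a fixed integer, let $\beta>r-2$ be a real number, and let $\mathcal{F}$ be a family of connected hypergraphs. Suppose there is a constant $c$ such that for every positive integer $n$ there is an edge coloring of $K_{n,\ldots,n}^{(r)}$ with at most $c\,n^{\beta}$ colors with no monochromatic $F\in\mathcal{F}$. Then there is a constant $c'$ such that for every positive integer $n$ there is an edge coloring of $K_n^{(r)}$ with at most $c'\,n^{\beta}$ colors with no monochromatic $F\in\mathcal{F}$.
   Context: $K_n^{(r)}$ denotes the complete $r$-uniform hypergraph on $n$ vertices (all $r$-element subsets of the vertex set are edges). $K_{n,\ldots,n}^{(r)}$ denotes the complete $r$-partite $r$-uniform hypergraph with $n$ vertices in each of its $r$ parts (its edges are all $r$-sets meeting each part in exactly one vertex). An edge coloring assigns one color to each hyperedge (it need not be proper). It has no monochromatic $F\in\mathcal{F}$ if, for every color, the hypergraph on the full vertex set formed by the edges of that color contains no subhypergraph (not necessarily induced) isomorphic to a member of $\mathcal{F}$. The constants $c,c'$ may depend on $r$, $\beta$ and $\mathcal{F}$ but not on $n$. *)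

theory Defs
  imports Complex_Main
begin

datatype 'a hypergraph = Hypergraph (verts: "'a set") (edges: "'a set set")

definition wf_hypergraph :: "'a hypergraph \<Rightarrow> bool" where
  "wf_hypergraph H \<longleftrightarrow> (\<forall>e\<in>edges H. e \<subseteq> verts H)"

definition subhypergraph :: "'a hypergraph \<Rightarrow> 'a hypergraph \<Rightarrow> bool" where
  "subhypergraph S H \<longleftrightarrow> wf_hypergraph S \<and> verts S \<subseteq> verts H \<and> edges S \<subseteq> edges H"

definition isomorphic_hypergraphs :: "'a hypergraph \<Rightarrow> 'b hypergraph \<Rightarrow> bool" where
  "isomorphic_hypergraphs F H \<longleftrightarrow>
     (\<exists>\<phi>. bij_betw \<phi> (verts F) (verts H) \<and> (\<lambda>e. \<phi> ` e) ` edges F = edges H)"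

definition contains_copy :: "'b hypergraph \<Rightarrow> 'a hypergraph \<Rightarrow> bool" where
  "contains_copy H F \<longleftrightarrow> (\<exists>S. subhypergraph S H \<and> isomorphic_hypergraphs F S)"

text \<open>Any two vertices are joined by a walk in which consecutive vertices lie in a common edge.\<close>

definition connected_hypergraph :: "'a hypergraph \<Rightarrow> bool" where
  "connected_hypergraph H \<longleftrightarrow> wf_hypergraph H \<and>
     (\<forall>u\<in>verts H. \<forall>v\<in>verts H. (u, v) \<in> {(x, y). \<exists>e\<in>edges H. x \<in> e \<and> y \<in> e}\<^sup>*)"

definition complete_hypergraph :: "nat \<Rightarrow> nat \<Rightarrow> nat hypergraph" where
  "complete_hypergraph r n = Hypergraph {..<n} {e. e \<subseteq> {..<n} \<and> card e = r}"

text \<open>Vertex \<open>(i, x)\<close> is the \<open>x\<close>-th vertex of the \<open>i\<close>-th part.\<close>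

definition complete_partite_hypergraph :: "nat \<Rightarrow> nat \<Rightarrow> (nat \<times> nat) hypergraph" where
  "complete_partite_hypergraph r n = Hypergraph ({..<r} \<times> {..<n})
     {e. e \<subseteq> {..<r} \<times> {..<n} \<and> card e = r \<and> (\<forall>i<r. card (e \<inter> ({i} \<times> {..<n})) = 1)}"

text \<open>An edge coloring with palette \<open>{..<k}\<close>; it need neither be proper nor use every color.\<close>

definition edge_coloring :: "'a hypergraph \<Rightarrow> nat \<Rightarrow> ('a set \<Rightarrow> nat) \<Rightarrow> bool" where
  "edge_coloring H k \<chi> \<longleftrightarrow> (\<forall>e\<in>edges H. \<chi> e < k)"

definition color_class :: "'a hypergraph \<Rightarrow> ('a set \<Rightarrow> nat) \<Rightarrow> nat \<Rightarrow> 'a hypergraph" where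
  "color_class H \<chi> i = Hypergraph (verts H) {e \<in> edges H. \<chi> e = i}"

definition no_monochromatic ::
    "'b hypergraph \<Rightarrow> nat \<Rightarrow> ('b set \<Rightarrow> nat) \<Rightarrow> 'a hypergraph set \<Rightarrow> bool" where
  "no_monochromatic H k \<chi> \<F> \<longleftrightarrow> (\<forall>i<k. \<forall>F\<in>\<F>. \<not> contains_copy (color_class H \<chi> i) F)"

end

theory Submission
  imports Defs
begin

text \<open>
  Choose \<open>L\<close> with \<open>n \<le> 2\<^sup>L \<le> 2n\<close> and cut the vertex set \<open>{..<2\<^sup>L}\<close>, for every
  \<open>t \<le> L\<close>, into \<open>2\<^sup>t\<close> consecutive blocks of length \<open>2\<^bsup>L-t\<^esup>\<close>. An edge \<open>e\<close> is filed under the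
  least depth \<open>t\<close> at which its \<open>r\<close> vertices lie in \<open>r\<close> different blocks; this set \<open>B\<close> of blocks
  spans a copy of \<open>K\<^bsub>m,\<dots>,m\<^esub>\<close> with \<open>m = 2\<^bsup>L-t\<^esup>\<close> that contains \<open>e\<close>, and for that hypergraph the
  hypothesis supplies a colouring with at most \<open>c m\<^sup>\<beta>\<close> colours.

  Colours can be shared between disjoint block sets: if each colour determines \<open>t\<close>, and the block
  sets with the same colour at depth \<open>t\<close> are pairwise disjoint, then two edges of one colour that
  share a vertex have the same block set. A connected monochromatic hypergraph therefore lies within
  a single copy of \<open>K\<^bsub>m,\<dots>,m\<^esub>\<close> (\<open>contains_copy_localize\<close>), which the given colouring excludes. So
  the colour of \<open>e\<close> is a triple: the depth \<open>t\<close>, a colour of \<open>B\<close> that separates intersecting block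
  sets, and the colour of \<open>e\<close> in the given colouring of the copy spanned by \<open>B\<close>.

  What makes the count work is that \<open>t\<close> is least. For \<open>t > 0\<close> the block set \<open>B\<close> then contains two
  halves of one block of depth \<open>t - 1\<close>, so a block set that meets a given one is fixed by only
  \<open>r - 2\<close> free blocks and boundedly many further choices. Hence each block set meets at most
  \<open>r\<^sup>2 (2\<^sup>t)\<^bsup>r-2\<^esup>\<close> block sets, itself included (\<open>card_block_sets_meeting\<close>), and greedy colouring needs no more colours
  than that. The total is at most
  \<open>\<Sum>t\<le>L. r\<^sup>2 (2\<^sup>t)\<^bsup>r-2\<^esup> \<cdot> c (2\<^bsup>L-t\<^esup>)\<^sup>\<beta> = r\<^sup>2 c (2\<^sup>L)\<^sup>\<beta> \<cdot> (\<Sum>t\<le>L. (2\<^bsup>r-2-\<beta>\<^esup>)\<^sup>t)\<close>,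
  and the last sum is bounded by a convergent geometric series because \<open>\<beta> > r - 2\<close>.
\<close>

section \<open>Copies of connected hypergraphs\<close>

lemma contains_copyE:
  assumes "contains_copy G F"
  obtains \<phi> where "inj_on \<phi> (verts F)" "\<phi> ` verts F \<subseteq> verts G"
    "\<And>e. e \<in> edges F \<Longrightarrow> \<phi> ` e \<in> edges G"
proof -
  obtain S \<phi> where "subhypergraph S G" "bij_betw \<phi> (verts F) (verts S)"
      "(\<lambda>e. \<phi> ` e) ` edges F = edges S"
    using assms unfolding contains_copy_def isomorphic_hypergraphs_def by blast
  then show thesis
    by (intro that[of \<phi>]) (auto simp: subhypergraph_def bij_betw_def)
qed

lemma contains_copyI:
  assumes "wf_hypergraph F" "inj_on \<phi> (verts F)" "\<phi> ` verts F \<subseteq> verts G"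
    "\<And>e. e \<in> edges F \<Longrightarrow> \<phi> ` e \<in> edges G"
  shows "contains_copy G F"
proof -
  let ?S = "Hypergraph (\<phi> ` verts F) ((\<lambda>e. \<phi> ` e) ` edges F)"
  have "subhypergraph ?S G"
    using assms by (auto simp: subhypergraph_def wf_hypergraph_def)
  moreover have "isomorphic_hypergraphs F ?S"
    unfolding isomorphic_hypergraphs_def using assms(2)
    by (intro exI[of _ \<phi>]) (auto simp: bij_betw_def)
  ultimately show ?thesis
    unfolding contains_copy_def by blast
qed

lemma contains_copy_inj_image:
  assumes "wf_hypergraph F" "contains_copy G F" "inj_on \<psi> (verts G)" "\<psi> ` verts G \<subseteq> verts K"
    "\<And>e. e \<in> edges G \<Longrightarrow> \<psi> ` e \<in> edges K"
  shows "contains_copy K F"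
proof -
  obtain \<phi> where \<phi>: "inj_on \<phi> (verts F)" "\<phi> ` verts F \<subseteq> verts G"
      "\<And>e. e \<in> edges F \<Longrightarrow> \<phi> ` e \<in> edges G"
    using contains_copyE[OF assms(2)] by blast
  show ?thesis
  proof (rule contains_copyI[OF assms(1), of "\<psi> \<circ> \<phi>"])
    show "inj_on (\<psi> \<circ> \<phi>) (verts F)"
      using \<phi> assms(3) by (meson comp_inj_on inj_on_subset)
    show "(\<psi> \<circ> \<phi>) ` verts F \<subseteq> verts K"
      using \<phi>(2) assms(4) by fastforce
    show "(\<psi> \<circ> \<phi>) ` e \<in> edges K" if "e \<in> edges F" for e
      using assms(5)[OF \<phi>(3)[OF that]] by (simp add: image_comp)
  qed
qed

text \<open>A connected hypergraph without edges has at most one vertex. If the family had such a member, no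
  colouring with a nonempty palette could avoid it; this rules out the one kind of connected
  hypergraph to which localisation does not apply.\<close>

lemma contains_copy_of_edgeless:
  assumes "connected_hypergraph F" "edges F = {}" "verts G \<noteq> {}"
  shows "contains_copy G F"
proof -
  obtain g where g: "g \<in> verts G" using assms(3) by blast
  have "u = v" if "u \<in> verts F" "v \<in> verts F" for u v
    using that assms(1,2) by (auto simp: connected_hypergraph_def)
  then have "inj_on (\<lambda>_. g) (verts F)"
    by (auto simp: inj_on_def)
  then show ?thesis
    using assms g by (intro contains_copyI[of _ "\<lambda>_. g"]) (auto simp: connected_hypergraph_def)
qed

lemma connected_hypergraph_constant_on_edges:
  assumes F: "connected_hypergraph F" and "{} \<notin> edges F"
    and meet: "\<And>e e'. e \<in> edges F \<Longrightarrow> e' \<in> edges F \<Longrightarrow> e \<inter> e' \<noteq> {} \<Longrightarrow> g e = g e'"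
    and e: "e \<in> edges F" and e': "e' \<in> edges F"
  shows "g e = g e'"
proof -
  obtain u v where uv: "u \<in> e" "v \<in> e'"
    using e e' \<open>{} \<notin> edges F\<close> by (metis ex_in_conv)
  then have "u \<in> verts F" "v \<in> verts F"
    using F e e' by (auto simp: connected_hypergraph_def wf_hypergraph_def)
  then have "(u, v) \<in> {(x, y). \<exists>e\<in>edges F. x \<in> e \<and> y \<in> e}\<^sup>*"
    using F by (auto simp: connected_hypergraph_def)
  then have "\<forall>d\<in>edges F. v \<in> d \<longrightarrow> g e = g d"
  proof induction
    case base
    then show ?case using meet e uv by blast
  next
    case (step y z)
    then obtain d where "d \<in> edges F" "y \<in> d" "z \<in> d" by blast
    then show ?case using step.IH meet by (metis disjoint_iff)
  qed
  then show ?thesis using uv e' by blast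
qed

lemma connected_hypergraph_covered:
  assumes F: "connected_hypergraph F" and "{} \<notin> edges F" "edges F \<noteq> {}"
  shows "verts F \<subseteq> \<Union>(edges F)"
proof
  fix v assume v: "v \<in> verts F"
  obtain e u where e: "e \<in> edges F" "u \<in> e" using assms by fastforce
  then have "u \<in> verts F"
    using F by (auto simp: connected_hypergraph_def wf_hypergraph_def)
  then have "(u, v) \<in> {(x, y). \<exists>e\<in>edges F. x \<in> e \<and> y \<in> e}\<^sup>*"
    using F v by (auto simp: connected_hypergraph_def)
  then show "v \<in> \<Union>(edges F)"
    using e by (cases rule: rtranclE) auto
qed

text \<open>Along a walk in \<open>F\<close> consecutive edges meet, so a label that agrees on meeting edges is constant
  on the copy of \<open>F\<close>. The vertex set shrinks as well, to the union of the edges with that label: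
  the map into block coordinates is injective on this union but not on all of \<open>G\<close>.\<close>

lemma contains_copy_localize:
  assumes F: "connected_hypergraph F" "edges F \<noteq> {}" and copy: "contains_copy G F"
    and G: "{} \<notin> edges G"
    and meet: "\<And>e e'. e \<in> edges G \<Longrightarrow> e' \<in> edges G \<Longrightarrow> e \<inter> e' \<noteq> {} \<Longrightarrow> g e = g e'"
  shows "\<exists>e0\<in>edges G. contains_copy
    (Hypergraph (\<Union>{e \<in> edges G. g e = g e0}) {e \<in> edges G. g e = g e0}) F"
proof -
  obtain \<phi> where \<phi>: "inj_on \<phi> (verts F)" "\<phi> ` verts F \<subseteq> verts G"
      "\<And>e. e \<in> edges F \<Longrightarrow> \<phi> ` e \<in> edges G"
    using contains_copyE[OF copy] by blast
  have ne: "{} \<notin> edges F"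
    using \<phi>(3) G by fastforce
  obtain d where d: "d \<in> edges F" using F by blast
  have eq: "g (\<phi> ` e) = g (\<phi> ` d)" if "e \<in> edges F" for e
  proof (rule connected_hypergraph_constant_on_edges[OF F(1) ne, of "\<lambda>e. g (\<phi> ` e)"])
    fix a b assume "a \<in> edges F" "b \<in> edges F" "a \<inter> b \<noteq> {}"
    then show "g (\<phi> ` a) = g (\<phi> ` b)"
      using \<phi>(3) by (intro meet) auto
  qed (use that d in auto)
  have "\<phi> ` verts F \<subseteq> \<Union>{e \<in> edges G. g e = g (\<phi> ` d)}"
    using connected_hypergraph_covered[OF F(1) ne F(2)] \<phi>(3) eq by fastforce
  then have "contains_copy (Hypergraph (\<Union>{e \<in> edges G. g e = g (\<phi> ` d)})
      {e \<in> edges G. g e = g (\<phi> ` d)}) F"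
    using F \<phi> eq by (intro contains_copyI[of _ \<phi>]) (auto simp: connected_hypergraph_def)
  then show ?thesis using \<phi>(3)[OF d] by blast
qed

section \<open>Greedy colouring of set families\<close>

text \<open>Colour the members one after another. The degree \<open>D\<close> counts the member itself, so the earlier
  members that meet a new one leave one of \<open>D\<close> colours free. No extra \<open>+ 1\<close> appears, so that an
  empty family is coloured with an empty palette; for \<open>r = 1\<close> this is needed at positive depths,
  where the bound on the number of colours is less than one.\<close>

lemma greedy_matching_coloring:
  fixes \<A> :: "'a set set"
  assumes "finite \<A>" "{} \<notin> \<A>" "\<And>A. A \<in> \<A> \<Longrightarrow> card {B \<in> \<A>. B \<inter> A \<noteq> {}} \<le> D"
  shows "\<exists>\<tau>. (\<forall>A\<in>\<A>. \<tau> A < D) \<and>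
    (\<forall>A\<in>\<A>. \<forall>B\<in>\<A>. A \<inter> B \<noteq> {} \<and> \<tau> A = \<tau> B \<longrightarrow> A = B)"
  using assms
proof (induction \<A> rule: finite_induct)
  case empty
  then show ?case by simp
next
  case (insert A \<A>)
  have "card {B \<in> \<A>. B \<inter> C \<noteq> {}} \<le> D" if "C \<in> \<A>" for C
  proof -
    have "card {B \<in> \<A>. B \<inter> C \<noteq> {}} \<le> card {B \<in> insert A \<A>. B \<inter> C \<noteq> {}}"
      using insert.hyps by (intro card_mono) auto
    then show ?thesis using insert.prems(2)[of C] that by auto
  qed
  then obtain \<tau> where \<tau>: "\<forall>A\<in>\<A>. \<tau> A < D"
      "\<forall>A\<in>\<A>. \<forall>B\<in>\<A>. A \<inter> B \<noteq> {} \<and> \<tau> A = \<tau> B \<longrightarrow> A = B"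
    using insert by auto
  let ?N = "{B \<in> \<A>. B \<inter> A \<noteq> {}}"
  have "{B \<in> insert A \<A>. B \<inter> A \<noteq> {}} = insert A ?N"
    using insert.prems(1) by auto
  then have "card ?N < D"
    using insert.prems(2)[of A] insert.hyps by simp
  moreover have "card (\<tau> ` ?N) \<le> card ?N"
    using insert.hyps by (intro card_image_le) auto
  ultimately have "\<not> {..<D} \<subseteq> \<tau> ` ?N"
    using card_mono[of "\<tau> ` ?N" "{..<D}"] insert.hyps by auto
  then obtain c where c: "c < D" "c \<notin> \<tau> ` ?N" by auto
  show ?case
  proof (intro exI[of _ "\<tau>(A := c)"] conjI ballI impI)
    show "(\<tau>(A := c)) B < D" if "B \<in> insert A \<A>" for B
      using that c \<tau> by auto
  next
    fix B C assume BC: "B \<in> insert A \<A>" "C \<in> insert A \<A>"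
      and eq: "B \<inter> C \<noteq> {} \<and> (\<tau>(A := c)) B = (\<tau>(A := c)) C"
    show "B = C"
    proof (cases "B = A \<or> C = A")
      case True
      then show ?thesis
        using BC eq c(2) by (auto split: if_splits simp: Int_commute)
    next
      case False
      then show ?thesis using BC eq \<tau>(2) by auto
    qed
  qed
qed

section \<open>Block sets containing a pair of siblings\<close>

definition sibling :: "nat \<Rightarrow> nat" where
  "sibling w = (if even w then w + 1 else w - 1)"

lemma sibling_eqI: "u div 2 = v div 2 \<Longrightarrow> u \<noteq> v \<Longrightarrow> u = sibling (v::nat)"
  unfolding sibling_def
  using div_mult_mod_eq[of u 2] div_mult_mod_eq[of v 2]
  by (cases "u mod 2 = 0"; cases "v mod 2 = 0") (simp_all add: even_iff_mod_2_eq_zero)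

text \<open>The \<open>r\<close>-sets of depth-\<open>t\<close> blocks, numbered from left to right, that can belong to an edge of
  depth \<open>t\<close>: the block \<open>b\<close> has the parent \<open>b div 2\<close> at depth \<open>t - 1\<close>, and for \<open>t > 0\<close> two of the
  blocks share their parent, since otherwise the edge would already be separated at depth \<open>t - 1\<close>.\<close>

definition block_sets :: "nat \<Rightarrow> nat \<Rightarrow> nat set set" where
  "block_sets r t = {B. B \<subseteq> {..<2 ^ t} \<and> card B = r \<and> (t = 0 \<or> \<not> inj_on (\<lambda>b. b div 2) B)}"

lemma finite_block_sets: "finite (block_sets r t)"
  by (rule finite_subset[of _ "Pow {..<2 ^ t}"]) (auto simp: block_sets_def)

text \<open>Let \<open>B\<close> meet \<open>A\<close> in \<open>b\<close>. Of two siblings in \<open>B\<close> at least one, \<open>v\<close>, differs from \<open>b\<close>. Then \<open>B\<close>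
  is determined by \<open>b\<close> (at most \<open>r\<close> choices in \<open>A\<close>), by \<open>B - {v, b}\<close> (at most \<open>(2\<^sup>t)\<^bsup>r-2\<^esup>\<close>
  choices), and by which of the at most \<open>r - 1\<close> members of \<open>B - {v}\<close> is the sibling of \<open>v\<close>.
  The case \<open>r = 1\<close> only occurs for \<open>t = 0\<close>, because a singleton contains no siblings.\<close>

lemma card_block_sets_meeting:
  assumes "r \<ge> 1" "A \<in> block_sets r t"
  shows "real (card {B \<in> block_sets r t. B \<inter> A \<noteq> {}}) \<le> (real r)\<^sup>2 * (2 ^ t) powr (real r - 2)"
proof (cases "t = 0")
  case True
  have "{B \<in> block_sets r t. B \<inter> A \<noteq> {}} \<subseteq> {{0}}"
    using True by (auto simp: block_sets_def lessThan_Suc)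
  then have "card {B \<in> block_sets r t. B \<inter> A \<noteq> {}} \<le> 1"
    using card_mono[of "{{0::nat}}"] by fastforce
  then have "real (card {B \<in> block_sets r t. B \<inter> A \<noteq> {}}) \<le> 1" by simp
  also have "1 \<le> (real r)\<^sup>2" using assms(1) by simp
  finally show ?thesis using True by simp
next
  case False
  have A: "A \<subseteq> {..<2 ^ t}" "card A = r" "\<not> inj_on (\<lambda>b. b div 2) A"
    using assms False by (auto simp: block_sets_def)
  have finA: "finite A" using A(1) finite_subset by blast
  have r2: "r \<ge> 2"
  proof (rule ccontr)
    assume "\<not> r \<ge> 2"
    then have "card A = 1" using assms(1) A(2) by simp
    then show False using A(3) by (auto simp: card_1_singleton_iff)
  qed
  let ?\<D> = "{D :: nat set. D \<subseteq> {..<2 ^ t} \<and> card D = r - 2}"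
  let ?P = "SIGMA b:A. SIGMA D:?\<D>. insert b D"
  let ?f = "\<lambda>(b, D, w). insert (sibling w) (insert b D)"
  have fin\<D>: "finite ?\<D>"
    by (rule finite_subset[of _ "Pow {..<2 ^ t}"]) auto
  have fin: "finite (insert b D)" if "D \<in> ?\<D>" for b D
    using that finite_subset by blast
  have "{B \<in> block_sets r t. B \<inter> A \<noteq> {}} \<subseteq> ?f ` ?P"
  proof
    fix B assume "B \<in> {B \<in> block_sets r t. B \<inter> A \<noteq> {}}"
    then obtain b where B: "B \<subseteq> {..<2 ^ t}" "card B = r" "\<not> inj_on (\<lambda>b. b div 2) B"
        and b: "b \<in> B" "b \<in> A"
      using False by (auto simp: block_sets_def)
    have finB: "finite B" using B(1) finite_subset by blast
    obtain v w where vw: "v \<in> B" "w \<in> B" "v \<noteq> w" "v div 2 = w div 2" "v \<noteq> b"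
      using B(3) unfolding inj_on_def by metis
    let ?D = "B - {v, b}"
    have "card ?D = r - 2"
      using vw b B(2) finB by (simp add: card_Diff_subset)
    then have in_P: "(b, ?D, w) \<in> ?P" using b vw B by auto
    have "B = ?f (b, ?D, w)"
      using sibling_eqI[OF vw(4,3)] vw b by auto
    then show "B \<in> ?f ` ?P" using in_P by (rule image_eqI)
  qed
  moreover have finP: "finite ?P"
    using fin\<D> fin finA by (intro finite_SigmaI) auto
  ultimately have "card {B \<in> block_sets r t. B \<inter> A \<noteq> {}} \<le> card ?P"
    by (meson surj_card_le)
  also have "card ?P = (\<Sum>b\<in>A. \<Sum>D\<in>?\<D>. card (insert b D))"
    using fin\<D> fin finA by (subst card_SigmaI) (auto intro!: sum.cong card_SigmaI finite_SigmaI)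
  also have "\<dots> \<le> (\<Sum>b\<in>A. \<Sum>D\<in>?\<D>. r)"
  proof (intro sum_mono)
    fix b D assume "D \<in> ?\<D>"
    then show "card (insert b D) \<le> r"
      using card_insert_le_m1[of r D b] r2 by auto
  qed
  also have "\<dots> = r\<^sup>2 * (2 ^ t choose (r - 2))"
    using A(2) n_subsets[of "{..<2 ^ t :: nat}" "r - 2"] by (simp add: power2_eq_square)
  also have "\<dots> \<le> r\<^sup>2 * (2 ^ t) ^ (r - 2)"
    by (cases "r - 2 \<le> 2 ^ t") (auto intro!: binomial_le_pow simp: binomial_eq_0)
  finally have "real (card {B \<in> block_sets r t. B \<inter> A \<noteq> {}}) \<le> real (r\<^sup>2 * (2 ^ t) ^ (r - 2))"
    by (simp only: of_nat_le_iff)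
  also have "\<dots> = (real r)\<^sup>2 * (2 ^ t) powr (real r - 2)"
    using r2 powr_realpow[of "2 ^ t" "r - 2"] by (simp add: of_nat_diff)
  finally show ?thesis .
qed

lemma block_sets_matching_coloring:
  assumes "r \<ge> 1"
  shows "\<exists>D \<tau>. real D \<le> (real r)\<^sup>2 * (2 ^ t) powr (real r - 2) \<and>
    (\<forall>A\<in>block_sets r t. \<tau> A < D) \<and>
    (\<forall>A\<in>block_sets r t. \<forall>B\<in>block_sets r t. A \<inter> B \<noteq> {} \<and> \<tau> A = \<tau> B \<longrightarrow> A = B)"
proof -
  define D where "D = nat \<lfloor>(real r)\<^sup>2 * (2 ^ t) powr (real r - 2)\<rfloor>"
  have "real D \<le> (real r)\<^sup>2 * (2 ^ t) powr (real r - 2)"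
    unfolding D_def by simp
  moreover have "\<exists>\<tau>. (\<forall>A\<in>block_sets r t. \<tau> A < D) \<and>
    (\<forall>A\<in>block_sets r t. \<forall>B\<in>block_sets r t. A \<inter> B \<noteq> {} \<and> \<tau> A = \<tau> B \<longrightarrow> A = B)"
  proof (rule greedy_matching_coloring[OF finite_block_sets])
    show "{} \<notin> block_sets r t" using assms by (auto simp: block_sets_def)
    show "card {B \<in> block_sets r t. B \<inter> A \<noteq> {}} \<le> D" if "A \<in> block_sets r t" for A
      using card_block_sets_meeting[OF assms that] unfolding D_def by (simp add: le_nat_floor)
  qed
  ultimately show ?thesis by (intro exI[of _ D]) simp
qed

section \<open>Blocks of an edge\<close>

text \<open>If the vertices of \<open>e\<close> lie in different blocks of length \<open>m\<close>, a numbering \<open>h\<close> of these blocks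
  sends each vertex to its block number and its offset within the block, and \<open>e\<close> becomes a
  transversal of the parts.\<close>

lemma block_coordinates_in_partite:
  assumes "m > 0" "card e = r" "inj_on (\<lambda>x. x div m) e"
    and h: "bij_betw h ((\<lambda>x. x div m) ` e) {..<r}"
  shows "(\<lambda>x. (h (x div m), x mod m)) ` e \<in> edges (complete_partite_hypergraph r m)"
proof -
  let ?\<psi> = "\<lambda>x. (h (x div m), x mod m)"
  have bij: "bij_betw (\<lambda>x. h (x div m)) e {..<r}"
    using bij_betw_trans[OF inj_on_imp_bij_betw[OF assms(3)] h] by (simp add: o_def)
  then have inj: "inj_on ?\<psi> e"
    by (auto simp: bij_betw_def inj_on_def)
  have "card (?\<psi> ` e \<inter> ({i} \<times> {..<m})) = 1" if "i < r" for i
  proof -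
    have "i \<in> (\<lambda>x. h (x div m)) ` e"
      using bij_betw_imp_surj_on[OF bij] that by simp
    then obtain x where x: "x \<in> e" "h (x div m) = i" by blast
    have uniq: "y = x" if "y \<in> e" "h (y div m) = i" for y
      using inj_onD[OF bij_betw_imp_inj_on[OF bij], of y x] that x by simp
    have "?\<psi> ` e \<inter> ({i} \<times> {..<m}) = {?\<psi> x}"
      using x assms(1) by (auto dest: uniq)
    then show ?thesis by simp
  qed
  moreover have "?\<psi> ` e \<subseteq> {..<r} \<times> {..<m}"
    using bij assms(1) by (auto simp: bij_betw_def)
  ultimately show ?thesis
    using assms(2) inj by (simp add: complete_partite_hypergraph_def card_image)
qed

text \<open>At depth \<open>t\<close> the vertex \<open>x\<close> lies in the block \<open>x div 2 ^ (L - t)\<close>. At depth \<open>L\<close> the blocks are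
  single vertices, so the least separating depth exists and is at most \<open>L\<close>.\<close>

definition depth :: "nat \<Rightarrow> nat set \<Rightarrow> nat" where
  "depth L e = (LEAST t. inj_on (\<lambda>x. x div 2 ^ (L - t)) e)"

definition blocks :: "nat \<Rightarrow> nat set \<Rightarrow> nat set" where
  "blocks L e = (\<lambda>x. x div 2 ^ (L - depth L e)) ` e"

lemma depth_le: "depth L e \<le> L"
  unfolding depth_def by (rule Least_le) simp

lemma inj_on_depth: "inj_on (\<lambda>x. x div 2 ^ (L - depth L e)) e"
  unfolding depth_def by (rule LeastI[of _ L]) simp

lemma blocks_in_block_sets:
  assumes "e \<subseteq> {..<2 ^ L}" "card e = r"
  shows "blocks L e \<in> block_sets r (depth L e)"
proof -
  let ?t = "depth L e"
  have "(2::nat) ^ L = 2 ^ ?t * 2 ^ (L - ?t)"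
    using depth_le[of L e] by (simp flip: power_add)
  then have "blocks L e \<subseteq> {..<2 ^ ?t}"
    using assms(1) by (auto simp: blocks_def less_mult_imp_div_less)
  moreover have "card (blocks L e) = r"
    using assms(2) inj_on_depth unfolding blocks_def by (simp add: card_image)
  moreover have "\<not> inj_on (\<lambda>b. b div 2) (blocks L e)" if "?t \<noteq> 0"
  proof
    assume "inj_on (\<lambda>b. b div 2) (blocks L e)"
    then have "inj_on ((\<lambda>b. b div 2) \<circ> (\<lambda>x. x div 2 ^ (L - ?t))) e"
      unfolding blocks_def by (intro comp_inj_on inj_on_depth)
    moreover have "L - (?t - 1) = Suc (L - ?t)"
      using that depth_le[of L e] by simp
    ultimately have "inj_on (\<lambda>x. x div 2 ^ (L - (?t - 1))) e"
      by (simp add: o_def div_mult2_eq[symmetric] mult.commute)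
    then have "?t \<le> ?t - 1"
      unfolding depth_def by (rule Least_le)
    then show False using that by simp
  qed
  ultimately show ?thesis by (auto simp: block_sets_def)
qed

section \<open>Colouring the complete hypergraph\<close>

text \<open>The sum is over depths: its first factor counts the colours of block sets, its second the colours
  used inside the complete partite hypergraph that a block set spans.\<close>

lemma complete_coloring_from_partite:
  fixes \<F> :: "'a hypergraph set"
  assumes r: "r \<ge> 1" and conn: "\<forall>F\<in>\<F>. connected_hypergraph F"
    and partite: "\<And>s. real (k s) \<le> c * (2 ^ s) powr \<beta>"
      "\<And>s. edge_coloring (complete_partite_hypergraph r (2 ^ s)) (k s) (\<chi> s)"
      "\<And>s. no_monochromatic (complete_partite_hypergraph r (2 ^ s)) (k s) (\<chi> s) \<F>"
    and n: "n \<le> 2 ^ L"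
  shows "\<exists>K \<kappa>. real K \<le> (\<Sum>t\<le>L. ((real r)\<^sup>2 * (2 ^ t) powr (real r - 2)) * (c * (2 ^ (L - t)) powr \<beta>)) \<and>
    edge_coloring (complete_hypergraph r n) K \<kappa> \<and>
    no_monochromatic (complete_hypergraph r n) K \<kappa> \<F>"
proof -
  \<comment> \<open>Otherwise parts of size one already violate the hypothesis: the partite hypergraph has an
    edge, so its palette is nonempty, and colour class 0 contains \<open>F\<close>.\<close>
  have F_edges: "edges F \<noteq> {}" if "F \<in> \<F>" for F
  proof
    assume "edges F = {}"
    let ?H = "complete_partite_hypergraph r (2 ^ 0)"
    have "(\<lambda>x. (x div 1, x mod 1)) ` {..<r} \<in> edges ?H"
      using block_coordinates_in_partite[of 1 "{..<r}" r id] by simp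
    then have "k 0 > 0"
      using partite(2)[of 0] unfolding edge_coloring_def by fastforce
    moreover have "contains_copy (color_class ?H (\<chi> 0) 0) F"
      using that conn r \<open>edges F = {}\<close>
      by (intro contains_copy_of_edgeless)
         (auto simp: color_class_def complete_partite_hypergraph_def lessThan_Suc lessThan_empty_iff)
    ultimately show False
      using partite(3)[of 0] that unfolding no_monochromatic_def by blast
  qed
  obtain D :: "nat \<Rightarrow> nat" and \<tau> :: "nat \<Rightarrow> nat set \<Rightarrow> nat" where
    D: "\<And>t. real (D t) \<le> (real r)\<^sup>2 * (2 ^ t) powr (real r - 2)" and
    \<tau>: "\<And>t A. A \<in> block_sets r t \<Longrightarrow> \<tau> t A < D t" and
    \<tau>_inj: "\<And>t A B. A \<in> block_sets r t \<Longrightarrow> B \<in> block_sets r t \<Longrightarrow> A \<inter> B \<noteq> {} \<Longrightarrow>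
              \<tau> t A = \<tau> t B \<Longrightarrow> A = B"
    using block_sets_matching_coloring[OF r] by metis
  have "\<exists>h. bij_betw h B {..<r}" if "B \<in> block_sets r t" for B t
    using that ex_bij_betw_finite_nat[of B] finite_subset[of B]
    by (auto simp: block_sets_def atLeast0LessThan)
  then obtain h :: "nat set \<Rightarrow> nat \<Rightarrow> nat" where
    h: "\<And>B t. B \<in> block_sets r t \<Longrightarrow> bij_betw (h B) B {..<r}"
    by metis
  \<comment> \<open>Block coordinates with respect to the block set \<open>B\<close>; injective on the union of the blocks in \<open>B\<close>.\<close>
  define \<psi> where "\<psi> t B x = (h B (x div 2 ^ (L - t)), x mod 2 ^ (L - t))" for t B and x :: nat
  define col where "col e = (depth L e, \<tau> (depth L e) (blocks L e),
    \<chi> (L - depth L e) (\<psi> (depth L e) (blocks L e) ` e))" for e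
  define P where "P = (SIGMA t:{..L}. {..<D t} \<times> {..<k (L - t)})"
  let ?H = "complete_hypergraph r n"
  have edge_blocks: "blocks L e \<in> block_sets r (depth L e)" if "e \<in> edges ?H" for e
    using that n by (intro blocks_in_block_sets) (auto simp: complete_hypergraph_def)
  have edge_\<psi>: "\<psi> (depth L e) (blocks L e) ` e
      \<in> edges (complete_partite_hypergraph r (2 ^ (L - depth L e)))" if "e \<in> edges ?H" for e
    unfolding \<psi>_def using that h[OF edge_blocks[OF that]]
    by (intro block_coordinates_in_partite inj_on_depth)
       (auto simp: complete_hypergraph_def blocks_def)
  have col_P: "col e \<in> P" if "e \<in> edges ?H" for e
    using that \<tau>[OF edge_blocks[OF that]] edge_\<psi>[OF that] partite(2) depth_le
    by (auto simp: P_def col_def edge_coloring_def)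
  have "finite P" unfolding P_def by auto
  then obtain g where g: "bij_betw g P {..<card P}"
    using ex_bij_betw_finite_nat by (metis atLeast0LessThan)
  have "real (card P) = (\<Sum>t\<le>L. real (D t) * real (k (L - t)))"
    by (simp add: P_def card_cartesian_product)
  also have "\<dots> \<le> (\<Sum>t\<le>L. ((real r)\<^sup>2 * (2 ^ t) powr (real r - 2)) * (c * (2 ^ (L - t)) powr \<beta>))"
    by (intro sum_mono mult_mono D partite) auto
  finally have card_P: "real (card P) \<le> \<dots>" .
  have coloring: "edge_coloring ?H (card P) (g \<circ> col)"
    using g col_P by (auto simp: edge_coloring_def bij_betw_def)
  have "no_monochromatic ?H (card P) (g \<circ> col) \<F>"
    unfolding no_monochromatic_def
  proof (intro allI impI ballI notI)
    fix i F assume F: "F \<in> \<F>" and copy: "contains_copy (color_class ?H (g \<circ> col) i) F"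
    let ?G = "color_class ?H (g \<circ> col) i"
    have G: "e \<in> edges ?H" if "e \<in> edges ?G" for e
      using that by (auto simp: color_class_def)
    have col_eq: "col e = col e'" if "e \<in> edges ?G" "e' \<in> edges ?G" for e e'
      using that g col_P[OF G[OF that(1)]] col_P[OF G[OF that(2)]]
      by (auto simp: color_class_def bij_betw_def dest: inj_onD)
    \<comment> \<open>Edges sharing a vertex have block sets sharing that vertex's block, so equal colours of these
      block sets force them to coincide.\<close>
    have meet: "blocks L e = blocks L e'"
      if "e \<in> edges ?G" "e' \<in> edges ?G" "e \<inter> e' \<noteq> {}" for e e'
    proof (rule \<tau>_inj)
      have eq: "depth L e = depth L e'" "\<tau> (depth L e) (blocks L e) = \<tau> (depth L e') (blocks L e')"
        using col_eq[OF that(1,2)] by (auto simp: col_def)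
      show "blocks L e \<in> block_sets r (depth L e)" using edge_blocks G that by blast
      show "blocks L e' \<in> block_sets r (depth L e)" using edge_blocks G that eq by metis
      show "blocks L e \<inter> blocks L e' \<noteq> {}" using that(3) eq(1) by (auto simp: blocks_def)
      show "\<tau> (depth L e) (blocks L e) = \<tau> (depth L e) (blocks L e')" using eq by simp
    qed
    have nonempty: "{} \<notin> edges ?G"
      using r by (auto simp: color_class_def complete_hypergraph_def)
    have F_conn: "connected_hypergraph F" using F conn by blast
    let ?local = "\<lambda>e0. Hypergraph (\<Union>{e \<in> edges ?G. blocks L e = blocks L e0})
      {e \<in> edges ?G. blocks L e = blocks L e0}"
    obtain e0 where e0: "e0 \<in> edges ?G" and loc: "contains_copy (?local e0) F"
      using contains_copy_localize[OF F_conn F_edges[OF F] copy nonempty, where g = "blocks L", OF meet]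
      by (rule bexE)
    define t where "t = depth L e0"
    define B where "B = blocks L e0"
    define j where "j = \<chi> (L - t) (\<psi> t B ` e0)"
    let ?K = "complete_partite_hypergraph r (2 ^ (L - t))"
    have B: "bij_betw (h B) B {..<r}"
      using h edge_blocks[OF G[OF e0]] B_def by blast
    \<comment> \<open>All edges of this colour with block set \<open>B\<close> have the same depth and the same inner colour, so
      one injection takes them into one colour class of one partite hypergraph.\<close>
    have e: "depth L e = t" "\<chi> (L - t) (\<psi> t B ` e) = j" "(\<lambda>x. x div 2 ^ (L - t)) ` e = B"
      "\<psi> t B ` e \<in> edges ?K"
      if "e \<in> edges ?G" "blocks L e = B" for e
      using col_eq[OF that(1) e0] that edge_\<psi>[OF G[OF that(1)]]
      by (auto simp: col_def t_def B_def j_def blocks_def)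
    have "contains_copy (color_class ?K (\<chi> (L - t)) j) F"
    proof (rule contains_copy_inj_image[OF _ loc, of "\<psi> t B"])
      show "wf_hypergraph F" using F_conn by (simp add: connected_hypergraph_def)
      have in_B: "x div 2 ^ (L - t) \<in> B" if "x \<in> verts (?local e0)" for x
        using that e(3) by (auto simp: B_def)
      show "inj_on (\<psi> t B) (verts (?local e0))"
      proof (rule inj_onI)
        fix x y assume "x \<in> verts (?local e0)" "y \<in> verts (?local e0)"
          and eq: "\<psi> t B x = \<psi> t B y"
        then have "x div 2 ^ (L - t) \<in> B" "y div 2 ^ (L - t) \<in> B" using in_B by blast+
        moreover have "h B (x div 2 ^ (L - t)) = h B (y div 2 ^ (L - t))"
          using eq by (simp add: \<psi>_def)
        ultimately have "x div 2 ^ (L - t) = y div 2 ^ (L - t)"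
          using inj_onD[OF bij_betw_imp_inj_on[OF B]] by blast
        moreover have "x mod 2 ^ (L - t) = y mod 2 ^ (L - t)" using eq by (simp add: \<psi>_def)
        ultimately show "x = y" by (metis div_mult_mod_eq)
      qed
      have "\<psi> t B x \<in> {..<r} \<times> {..<2 ^ (L - t)}" if "x \<in> verts (?local e0)" for x
        using bij_betwE[OF B] in_B[OF that] by (simp add: \<psi>_def)
      then show "\<psi> t B ` verts (?local e0) \<subseteq> verts (color_class ?K (\<chi> (L - t)) j)"
        unfolding color_class_def complete_partite_hypergraph_def hypergraph.sel by blast
      show "\<psi> t B ` e \<in> edges (color_class ?K (\<chi> (L - t)) j)" if "e \<in> edges (?local e0)" for e
        using that e(2,4)[of e] by (auto simp: color_class_def B_def)
    qed
    moreover have "j < k (L - t)"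
      using e(2,4)[of e0] e0 partite(2)[of "L - t"] by (auto simp: B_def edge_coloring_def)
    ultimately show False
      using partite(3)[of "L - t"] F unfolding no_monochromatic_def by blast
  qed
  with card_P coloring show ?thesis by blast
qed

section \<open>Counting colours\<close>

text \<open>The two powers at depth \<open>t\<close> multiply to \<open>(2\<^sup>L)\<^sup>\<beta>\<close> times the \<open>t\<close>-th power of a ratio that does
  not depend on \<open>L\<close>.\<close>

lemma geometric_level_sum:
  fixes A a c \<beta> :: real
  shows "(\<Sum>t\<le>L. (A * (2 ^ t) powr a) * (c * (2 ^ (L - t)) powr \<beta>))
    = A * c * (2 ^ L) powr \<beta> * (\<Sum>t\<le>L. (2 powr (a - \<beta>)) ^ t)"
proof -
  have level: "(A * (2 ^ t) powr a) * (c * (2 ^ (L - t)) powr \<beta>)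
      = A * c * (2 ^ L) powr \<beta> * (2 powr (a - \<beta>)) ^ t" if "t \<le> L" for t
  proof -
    have "((2::real) powr real t) powr a * (2 powr real (L - t)) powr \<beta>
        = 2 powr (real t * a + real (L - t) * \<beta>)"
      by (simp only: powr_powr powr_add)
    also have "real t * a + real (L - t) * \<beta> = real L * \<beta> + (a - \<beta>) * real t"
      using that by (simp add: of_nat_diff algebra_simps)
    also have "2 powr \<dots> = (2 powr real L) powr \<beta> * (2 powr (a - \<beta>)) powr real t"
      by (simp only: powr_powr powr_add)
    finally have "(2 ^ t) powr a * (2 ^ (L - t)) powr \<beta>
        = (2 ^ L) powr \<beta> * (2 powr (a - \<beta>)) ^ t"
      by (simp add: powr_realpow)
    then show ?thesis
      by (metis (no_types, opaque_lifting) mult.assoc mult.left_commute)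
  qed
  show ?thesis
    unfolding sum_distrib_left by (intro sum.cong refl level) simp
qed

lemma dyadic_bracket:
  fixes n :: nat
  assumes "n \<ge> 1"
  obtains L where "n \<le> 2 ^ L" "2 ^ L \<le> 2 * n"
proof -
  define L where "L = (LEAST L. n \<le> 2 ^ L)"
  have "n \<le> 2 ^ n" by simp
  then have 1: "n \<le> 2 ^ L" unfolding L_def by (rule LeastI)
  have "2 ^ L \<le> 2 * n"
  proof (cases L)
    case 0
    then show ?thesis using assms by simp
  next
    case (Suc l)
    then have "\<not> n \<le> 2 ^ l" using not_less_Least[of l "\<lambda>L. n \<le> 2 ^ L"] unfolding L_def by simp
    then show ?thesis using Suc by simp
  qed
  with 1 show thesis using that by blast
qed

theorem theorem1p1:
  fixes r :: nat and \<beta> :: real and \<F> :: "'a hypergraph set"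
  assumes "r \<ge> 1"
    and "\<beta> > real r - 2"
    and "\<forall>F\<in>\<F>. connected_hypergraph F"
    and "\<exists>c::real. \<forall>n::nat. n \<ge> 1 \<longrightarrow>
           (\<exists>k \<chi>. real k \<le> c * real n powr \<beta> \<and>
              edge_coloring (complete_partite_hypergraph r n) k \<chi> \<and>
              no_monochromatic (complete_partite_hypergraph r n) k \<chi> \<F>)"
  shows "\<exists>c'::real. \<forall>n::nat. n \<ge> 1 \<longrightarrow>
           (\<exists>k \<chi>. real k \<le> c' * real n powr \<beta> \<and>
              edge_coloring (complete_hypergraph r n) k \<chi> \<and>
              no_monochromatic (complete_hypergraph r n) k \<chi> \<F>)"
proof -
  obtain c :: real where c: "\<And>n. n \<ge> 1 \<Longrightarrow> (\<exists>k \<chi>. real k \<le> c * real n powr \<beta> \<and>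
              edge_coloring (complete_partite_hypergraph r n) k \<chi> \<and>
              no_monochromatic (complete_partite_hypergraph r n) k \<chi> \<F>)"
    using assms(4) by blast
  have "c \<ge> 0"
    using c[of 1] by (auto intro: order_trans[OF of_nat_0_le_iff])
  have "\<exists>k \<chi>. real k \<le> c * (2 ^ s) powr \<beta> \<and>
              edge_coloring (complete_partite_hypergraph r (2 ^ s)) k \<chi> \<and>
              no_monochromatic (complete_partite_hypergraph r (2 ^ s)) k \<chi> \<F>" for s
    using c[of "2 ^ s"] by simp
  then obtain k \<chi> where k\<chi>: "\<And>s. real (k s) \<le> c * (2 ^ s) powr \<beta>"
      "\<And>s. edge_coloring (complete_partite_hypergraph r (2 ^ s)) (k s) (\<chi> s)"
      "\<And>s. no_monochromatic (complete_partite_hypergraph r (2 ^ s)) (k s) (\<chi> s) \<F>"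
    by metis
  define q :: real where "q = 2 powr (real r - 2 - \<beta>)"
  have q: "0 < q" "q < 1"
    using assms(2) powr_less_mono[of "real r - 2 - \<beta>" 0 2] by (auto simp: q_def)
  define c' where "c' = (real r)\<^sup>2 * c * 2 powr \<bar>\<beta>\<bar> / (1 - q)"
  have "\<exists>K \<kappa>. real K \<le> c' * real n powr \<beta> \<and>
              edge_coloring (complete_hypergraph r n) K \<kappa> \<and>
              no_monochromatic (complete_hypergraph r n) K \<kappa> \<F>" if n: "n \<ge> 1" for n
  proof -
    obtain L where L: "n \<le> 2 ^ L" "2 ^ L \<le> 2 * n" by (rule dyadic_bracket[OF n])
    then have "real n \<le> real (2 ^ L)" "real (2 ^ L) \<le> real (2 * n)"
      by (simp_all only: of_nat_le_iff)
    then have Lr: "real n \<le> 2 ^ L" "2 ^ L \<le> 2 * real n"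
      by simp_all
    \<comment> \<open>The absolute value covers \<open>\<beta> < 0\<close>, which is possible for \<open>r = 1\<close>.\<close>
    have pow: "(2 ^ L) powr \<beta> \<le> 2 powr \<bar>\<beta>\<bar> * real n powr \<beta>"
    proof (cases "\<beta> \<ge> 0")
      case True
      then have "(2 ^ L) powr \<beta> \<le> (2 * real n) powr \<beta>" using Lr by (intro powr_mono2) auto
      then show ?thesis using True by (simp add: powr_mult)
    next
      case False
      then have "(2 ^ L) powr \<beta> \<le> real n powr \<beta>" using Lr n by (intro powr_mono2') auto
      also have "\<dots> \<le> 2 powr \<bar>\<beta>\<bar> * real n powr \<beta>"
        using ge_one_powr_ge_zero[of 2 "\<bar>\<beta>\<bar>"] by (simp add: mult_le_cancel_right1)
      finally show ?thesis .
    qed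
    have "(\<Sum>t\<le>L. q ^ t) \<le> (\<Sum>t. q ^ t)"
      using q by (intro sum_le_suminf summable_geometric) auto
    also have "\<dots> = 1 / (1 - q)" using q by (intro suminf_geometric) auto
    finally have geo: "(\<Sum>t\<le>L. q ^ t) \<le> 1 / (1 - q)" .
    have "(\<Sum>t\<le>L. ((real r)\<^sup>2 * (2 ^ t) powr (real r - 2)) * (c * (2 ^ (L - t)) powr \<beta>))
        = (real r)\<^sup>2 * c * (2 ^ L) powr \<beta> * (\<Sum>t\<le>L. q ^ t)"
      using geometric_level_sum by (simp add: q_def)
    also have "\<dots> \<le> (real r)\<^sup>2 * c * (2 powr \<bar>\<beta>\<bar> * real n powr \<beta>) * (1 / (1 - q))"
      using pow geo q \<open>c \<ge> 0\<close> by (intro mult_mono mult_left_mono sum_nonneg mult_nonneg_nonneg) auto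
    also have "\<dots> = c' * real n powr \<beta>" by (simp add: c'_def)
    finally show ?thesis
      using complete_coloring_from_partite[OF assms(1,3) k\<chi> L(1)] by (meson order_trans)
  qed
  then show ?thesis by blast
qed

end
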